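(* Fix $q\in(0,1)$. For every integer $k\ge 1$ there is a constant $\tilde c_k>0$, depending only on $k$ (and on the fixed $q$), such that for all integers $n_1, n$ with $k\le n_1\le n$, $$\big\|(e^q_{n,n_1})_k-(\nu^q_{q^{n_1}})_k\big\|\ge \tilde c_k\, q^{n}.$$
   Context: $q\in(0,1)$ is fixed. Notation: $[m]=\frac{1-q^m}{1-q}$, $[m]!=[1][2]\cdots[m]$, $\begin{bmatrix} n \\ k \end{bmatrix}=\frac{[n]!}{[k]!\,[n-k]!}$. For $\omega\in\{0,1\}^n$ put $\mathrm{inv}(\omega)=\#\{(i,j):1\le i<j\le n,\ \omega_i<\omega_j\}$. For $0\le n_1\le n$, $e^q_{n,n_1}$ is the probability measure on $\{0,1\}^n$ with $e^q_{n,n_1}(\omega)=q^{\mathrm{inv}(\omega)}\big/\begin{bmatrix} n \\ n_1 \end{bmatrix}$ if $\omega$ contains exactly $n_1$ ones, and $e^q_{n,n_1}(\omega)=0$ otherwise. A probability measure $\mathbb{P}$ on $\{0,1\}^n$ is $q$-exchangeable if for every $(\varepsilon_1,\dots,\varepsilon_n)\in\{0,1\}^n$ and $1\le i\le n-1$, $\mathbb{P}(\varepsilon_1,\dots,\varepsilon_{i-1},\varepsilon_{i+1},\varepsilon_i,\varepsilon_{i+2},\dots,\varepsilon_n)=q^{\varepsilon_i-\varepsilon_{i+1}}\mathbb{P}(\varepsilon_1,\dots,\varepsilon_n)$. For $x\in\Delta_q=\{1,q,q^2,\dots\}\cup\{0\}$, $\nu^q_x$ is the unique $q$-exchangeable probability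 measure on $\{0,1\}^n$ such that for $0\le j\le n$ the sequence of $j$ ones followed by $n-j$ zeros has probability $q^{-j(n-j)}x^{n-j}(x;q^{-1})_j$, where $(x;q^{-1})_j=\prod_{i=0}^{j-1}(1-xq^{-i})$, $(x;q^{-1})_0=1$, $0^0=1$. For a measure $\mathbb{P}$ on $\{0,1\}^n$ and $k\le n$, $\mathbb{P}_k$ is its pushforward under the projection onto the first $k$ coordinates. The variational distance of probability measures on $\{0,1\}^k$ is $\|\mu-\nu\|=2\sup_{A\subset\{0,1\}^k}|\mu(A)-\nu(A)|$. *)

theory Defs
  imports "HOL-Probability.Probability"
begin

text \<open>
  A word in $\{0,1\}^n$ is a list of booleans of length $n$, with \<^const>\<open>True\<close> for $1$ and
  \<^const>\<open>False\<close> for $0$.  A probability measure on $\{0,1\}^n$ is a pmf on lists whose support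
  is contained in \<open>words n\<close>.  List positions are counted from $0$.
\<close>

definition words :: "nat \<Rightarrow> bool list set" where
  "words n = {w. length w = n}"

definition ones :: "bool list \<Rightarrow> nat" where
  "ones w = count_list w True"

definition inversions :: "bool list \<Rightarrow> nat" where
  "inversions w = card {(i, j). i < j \<and> j < length w \<and> w ! i < w ! j}"

definition q_nat :: "real \<Rightarrow> nat \<Rightarrow> real" where
  "q_nat q m = (1 - q ^ m) / (1 - q)"

definition q_fact :: "real \<Rightarrow> nat \<Rightarrow> real" where
  "q_fact q m = (\<Prod>i = 1..m. q_nat q i)"

definition q_binomial :: "real \<Rightarrow> nat \<Rightarrow> nat \<Rightarrow> real" where
  "q_binomial q n k = q_fact q n / (q_fact q k * q_fact q (n - k))"

definition q_pochhammer :: "real \<Rightarrow> real \<Rightarrow> nat \<Rightarrow> real" where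
  "q_pochhammer a b j = (\<Prod>i<j. 1 - a * b ^ i)"

text \<open>
  \<^const>\<open>embed_pmf\<close> is only specified for nonnegative weights of total mass $1$; for
  $0 < q < 1$ and $n_1 \le n$ this is the content of \<open>pmf_e_pmf\<close> below.
\<close>

definition e_weight :: "real \<Rightarrow> nat \<Rightarrow> nat \<Rightarrow> bool list \<Rightarrow> real" where
  "e_weight q n n1 w =
     (if w \<in> words n \<and> ones w = n1 then q ^ inversions w / q_binomial q n n1 else 0)"

definition e_pmf :: "real \<Rightarrow> nat \<Rightarrow> nat \<Rightarrow> bool list pmf" where
  "e_pmf q n n1 = embed_pmf (e_weight q n n1)"

definition q_exchangeable :: "real \<Rightarrow> nat \<Rightarrow> bool list pmf \<Rightarrow> bool" where
  "q_exchangeable q n P \<longleftrightarrow>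
     set_pmf P \<subseteq> words n \<and>
     (\<forall>w\<in>words n. \<forall>i. Suc i < n \<longrightarrow>
        pmf P (w[i := w ! Suc i, Suc i := w ! i]) =
          q powi (of_bool (w ! i) - of_bool (w ! Suc i)) * pmf P w)"

definition Delta_q :: "real \<Rightarrow> real set" where
  "Delta_q q = range (\<lambda>m. q ^ m) \<union> {0}"

definition nu_spec :: "real \<Rightarrow> nat \<Rightarrow> real \<Rightarrow> bool list pmf \<Rightarrow> bool" where
  "nu_spec q n x P \<longleftrightarrow>
     q_exchangeable q n P \<and>
     (\<forall>j\<le>n. pmf P (replicate j True @ replicate (n - j) False) =
        q powi (- int (j * (n - j))) * x ^ (n - j) * q_pochhammer x (1 / q) j)"

text \<open>Existence and uniqueness for $x \in \Delta_q$ are proved in \<open>nu_spec_ex1\<close> below.\<close>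

definition nu_pmf :: "real \<Rightarrow> nat \<Rightarrow> real \<Rightarrow> bool list pmf" where
  "nu_pmf q n x = (THE P. nu_spec q n x P)"

definition marginal :: "nat \<Rightarrow> bool list pmf \<Rightarrow> bool list pmf" where
  "marginal k P = map_pmf (take k) P"

definition var_dist :: "nat \<Rightarrow> bool list pmf \<Rightarrow> bool list pmf \<Rightarrow> real" where
  "var_dist k \<mu> \<nu> =
     2 * (SUP A\<in>Pow (words k). \<bar>measure_pmf.prob \<mu> A - measure_pmf.prob \<nu> A\<bar>)"


subsection \<open>Words and inversions\<close>

lemma finite_words [simp]: "finite (words n)"
  using finite_lists_length_eq[of "UNIV :: bool set" n] by (simp add: words_def)

lemma words_0 [simp]: "words 0 = {[]}"
  by (auto simp: words_def)

lemma words_Suc: "words (Suc n) = Cons True ` words n \<union> Cons False ` words n"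
  by (auto simp: words_def length_Suc_conv image_iff)

lemma words_Suc_snoc:
  "words (Suc n) = (\<lambda>w. w @ [True]) ` words n \<union> (\<lambda>w. w @ [False]) ` words n"
proof -
  have "w \<in> (\<lambda>w. w @ [True]) ` words n \<union> (\<lambda>w. w @ [False]) ` words n"
    if "length w = Suc n" for w
    using that by (cases w rule: rev_cases) (auto simp: words_def image_iff)
  then show ?thesis by (auto simp: words_def)
qed

lemma sum_words_Suc:
  "(\<Sum>w\<in>words (Suc n). f w) = (\<Sum>w\<in>words n. f (True # w)) + (\<Sum>w\<in>words n. f (False # w))"
  for f :: "bool list \<Rightarrow> real"
  unfolding words_Suc by (subst sum.union_disjoint) (auto simp: sum.reindex)

lemma sum_words_Suc_snoc:
  "(\<Sum>w\<in>words (Suc n). f w) = (\<Sum>w\<in>words n. f (w @ [True]) + f (w @ [False]))"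
  for f :: "bool list \<Rightarrow> real"
  unfolding words_Suc_snoc
  by (subst sum.union_disjoint) (auto simp: sum.reindex inj_on_def sum.distrib)

lemma ones_simps [simp]:
  "ones [] = 0" "ones (a # w) = of_bool a + ones w" "ones (v @ w) = ones v + ones w"
  by (auto simp: ones_def)

lemma ones_le_length: "ones w \<le> length w"
  by (simp add: ones_def count_le_length)

lemma ones_eq_card: "ones w = card {i. i < length w \<and> w ! i}"
  by (simp add: ones_def count_list_eq_length_filter length_filter_conv_card)

lemma inversions_Nil [simp]: "inversions [] = 0"
  by (simp add: inversions_def)

lemma inversions_Cons [simp]:
  "inversions (a # w) = (if a then 0 else ones w) + inversions w"
proof -
  let ?I = "{(i, j). i < j \<and> j < length w \<and> w ! i < w ! j}"
  let ?J = "{j. j < length w \<and> a < w ! j}"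
  have fin: "finite ?I"
    by (rule finite_subset[of _ "{..<length w} \<times> {..<length w}"]) auto
  have eq: "{(i, j). i < j \<and> j < length (a # w) \<and> (a # w) ! i < (a # w) ! j} =
      (\<lambda>j. (0, Suc j)) ` ?J \<union> (\<lambda>(i, j). (Suc i, Suc j)) ` ?I" (is "?L = ?R")
  proof (intro set_eqI)
    fix p :: "nat \<times> nat"
    obtain i j where "p = (i, j)" by (cases p)
    then show "p \<in> ?L \<longleftrightarrow> p \<in> ?R"
      by (cases i; cases j) (auto simp: image_iff)
  qed
  have "inversions (a # w) = card ?J + card ?I"
    unfolding inversions_def eq using fin
    by (subst card_Un_disjoint) (auto simp: card_image inj_on_def)
  then show ?thesis
    by (cases a) (simp_all add: inversions_def ones_eq_card)
qed

lemma inversions_append: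
  "inversions (v @ w) = inversions v + inversions w + (length v - ones v) * ones w"
proof (induction v)
  case (Cons a v)
  have "ones v \<le> length v" by (rule ones_le_length)
  then have "Suc (length v) - ones v = Suc (length v - ones v)" by simp
  then show ?case using Cons by (cases a) simp_all
qed simp

lemma ones_replicate [simp]: "ones (replicate j b) = (if b then j else 0)"
  by (induction j) auto

lemma inversions_replicate [simp]: "inversions (replicate j b) = 0"
  by (induction j) auto

lemma swap_append:
  "(u @ a # b # v)[length u := (u @ a # b # v) ! Suc (length u),
     Suc (length u) := (u @ a # b # v) ! length u] = u @ b # a # v"
  by (simp add: nth_append list_update_append)

lemma word_split:
  assumes "w \<in> words n" "Suc i < n"
  obtains u a b v where "w = u @ a # b # v" "length u = i"
proof -
  have "w = take i w @ w ! i # w ! Suc i # drop (Suc (Suc i)) w"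
    using assms by (simp add: words_def Cons_nth_drop_Suc)
  moreover have "length (take i w) = i" using assms by (simp add: words_def)
  ultimately show ?thesis using that by blast
qed

lemma word_cases:
  obtains "w = replicate (ones w) True @ replicate (length w - ones w) False"
  | u v where "w = u @ False # True # v"
proof -
  have "w = replicate (ones w) True @ replicate (length w - ones w) False \<or>
      (\<exists>u v. w = u @ False # True # v)"
  proof (induction w)
    case (Cons a w)
    show ?case
    proof (cases "\<exists>u v. w = u @ False # True # v")
      case True
      then obtain u v where "a # w = (a # u) @ False # True # v" by auto
      then show ?thesis by blast
    next
      case False
      with Cons have w: "w = replicate (ones w) True @ replicate (length w - ones w) False"
        by blast
      show ?thesis
      proof (cases a)
        case True
        then show ?thesis using w by simp
      next
        case a: False
        show ?thesis
        proof (cases "ones w")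
          case 0
          then show ?thesis using w a by simp
        next
          case (Suc m)
          then have "a # w =
              [] @ False # True # (replicate m True @ replicate (length w - ones w) False)"
            using a by (subst w) simp
          then show ?thesis by blast
        qed
      qed
    qed
  qed simp
  then show ?thesis using that by blast
qed


subsection \<open>The measures $e^q_{n,n_1}$ are well defined\<close>

lemma q_nat_pos: "0 < q \<Longrightarrow> q < 1 \<Longrightarrow> 0 < m \<Longrightarrow> 0 < q_nat q m"
  by (simp add: q_nat_def power_less_one_iff)

lemma q_fact_pos: "0 < q \<Longrightarrow> q < 1 \<Longrightarrow> 0 < q_fact q m"
  unfolding q_fact_def by (intro prod_pos ballI q_nat_pos) auto

lemma q_binomial_pos: "0 < q \<Longrightarrow> q < 1 \<Longrightarrow> 0 < q_binomial q n k"
  by (simp add: q_binomial_def q_fact_pos)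

lemma q_fact_Suc: "q_fact q (Suc m) = q_nat q (Suc m) * q_fact q m"
  by (simp add: q_fact_def mult.commute)

lemma q_binomial_0: "0 < q \<Longrightarrow> q < 1 \<Longrightarrow> q_binomial q n 0 = 1"
  using q_fact_pos[of q n] q_fact_pos[of q 0] by (simp add: q_binomial_def q_fact_def [of q 0])

lemma q_binomial_self: "0 < q \<Longrightarrow> q < 1 \<Longrightarrow> q_binomial q n n = 1"
  using q_fact_pos[of q n] q_fact_pos[of q 0] by (simp add: q_binomial_def q_fact_def [of q 0])

lemma q_binomial_rec:
  assumes q: "0 < q" "q < 1" and "k < n"
  shows "q_binomial q (Suc n) (Suc k) =
    q_binomial q n k + q ^ Suc k * q_binomial q n (Suc k)"
proof -
  obtain m where n: "n = Suc (k + m)" using \<open>k < n\<close> less_iff_Suc_add by auto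
  have p: "q_fact q k > 0" "q_fact q m > 0" "q_nat q (Suc k) > 0" "q_nat q (Suc m) > 0"
    using q q_fact_pos q_nat_pos by auto
  have "q ^ Suc (Suc (k + m)) = q ^ Suc k * q ^ Suc m" by (simp add: power_add)
  then have *: "q_nat q (Suc n) = q_nat q (Suc k) + q ^ Suc k * q_nat q (Suc m)"
    using q unfolding n q_nat_def by (simp add: field_simps)
  have d: "Suc n - Suc k = Suc m" "n - k = Suc m" "n - Suc k = m" using n by auto
  show ?thesis
    unfolding q_binomial_def d q_fact_Suc * using p by (simp add: field_simps)
qed

lemma sum_inversions:
  assumes q: "0 < q" "q < 1" and "k \<le> n"
  shows "(\<Sum>w\<in>words n. if ones w = k then q ^ inversions w else 0) = q_binomial q n k"
  using \<open>k \<le> n\<close>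
proof (induction n arbitrary: k)
  case 0
  then show ?case using q by (simp add: q_binomial_0)
next
  case (Suc n)
  let ?W = "\<lambda>n k. \<Sum>w\<in>words n. if ones w = k then q ^ inversions w else 0"
  have over: "?W n (Suc n) = 0"
  proof (rule sum.neutral, safe)
    fix w assume "w \<in> words n"
    then show "(if ones w = Suc n then q ^ inversions w else 0) = 0"
      using ones_le_length[of w] by (auto simp: words_def)
  qed
  have F: "(\<Sum>w\<in>words n. if ones (False # w) = k then q ^ inversions (False # w) else 0) =
      q ^ k * ?W n k"
    unfolding sum_distrib_left by (intro sum.cong) (auto simp: power_add)
  show ?case
  proof (cases k)
    case 0
    then show ?thesis using F Suc.IH[of 0] q by (simp add: sum_words_Suc q_binomial_0)
  next
    case (Suc k')
    have T: "(\<Sum>w\<in>words n. if ones (True # w) = k then q ^ inversions (True # w) else 0) =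
        ?W n k'"
      using Suc by (intro sum.cong) auto
    have W: "?W (Suc n) k = ?W n k' + q ^ k * ?W n k"
      unfolding sum_words_Suc T F ..
    show ?thesis
    proof (cases "k' = n")
      case True
      then show ?thesis using W over Suc Suc.IH[of n] q by (simp add: q_binomial_self)
    next
      case False
      then have "k' < n" using Suc Suc.prems by simp
      then show ?thesis
        using W Suc Suc.IH[of k'] Suc.IH[of k] q_binomial_rec[OF q, of k' n] by simp
    qed
  qed
qed

lemma pmf_embed_words:
  fixes f :: "bool list \<Rightarrow> real"
  assumes nonneg: "\<And>w. 0 \<le> f w" and out: "\<And>w. w \<notin> words n \<Longrightarrow> f w = 0"
    and sum1: "(\<Sum>w\<in>words n. f w) = 1"
  shows "pmf (embed_pmf f) w = f w"
proof (rule pmf_embed_pmf[OF nonneg])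
  have "(\<integral>\<^sup>+ w. ennreal (f w) \<partial>count_space UNIV) = (\<Sum>w\<in>words n. ennreal (f w))"
    using out by (intro nn_integral_count_space') auto
  also have "\<dots> = 1" using nonneg sum1 by (subst sum_ennreal) auto
  finally show "(\<integral>\<^sup>+ w. ennreal (f w) \<partial>count_space UNIV) = 1" .
qed

lemma pmf_e_pmf:
  assumes q: "0 < q" "q < 1" and "n1 \<le> n"
  shows "pmf (e_pmf q n n1) w = e_weight q n n1 w"
  unfolding e_pmf_def
proof (rule pmf_embed_words[where n = n])
  have pos: "q_binomial q n n1 > 0" using q by (rule q_binomial_pos)
  show "0 \<le> e_weight q n n1 w" for w
    using pos q by (simp add: e_weight_def)
  show "e_weight q n n1 w = 0" if "w \<notin> words n" for w
    using that by (simp add: e_weight_def)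
  have "(\<Sum>w\<in>words n. e_weight q n n1 w) =
      (\<Sum>w\<in>words n. if ones w = n1 then q ^ inversions w else 0) / q_binomial q n n1"
    unfolding sum_divide_distrib by (intro sum.cong) (auto simp: e_weight_def)
  then show "(\<Sum>w\<in>words n. e_weight q n n1 w) = 1"
    using sum_inversions[OF q \<open>n1 \<le> n\<close>] pos by simp
qed


subsection \<open>The measures $\nu^q_x$ are well defined\<close>

definition nu_weight :: "real \<Rightarrow> nat \<Rightarrow> real \<Rightarrow> bool list \<Rightarrow> real" where
  "nu_weight q n x w = (if w \<in> words n then
     q ^ inversions w * (q powi (- int (ones w * (n - ones w))) * x ^ (n - ones w) *
       q_pochhammer x (1 / q) (ones w)) else 0)"

lemma nu_weight_word:
  "w \<in> words n \<Longrightarrow> nu_weight q n x w = q ^ inversions w *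
     (x ^ (n - ones w) * q_pochhammer x (1 / q) (ones w) / q ^ (ones w * (n - ones w)))"
  unfolding nu_weight_def power_int_minus power_int_of_nat by (simp add: divide_inverse mult_ac)

lemma q_pochhammer_nonneg:
  assumes q: "0 < q" "q < 1" and "x \<in> Delta_q q"
  shows "0 \<le> q_pochhammer x (1 / q) j"
proof -
  consider m where "x = q ^ m" | "x = 0" using assms by (auto simp: Delta_q_def)
  then show ?thesis
  proof cases
    case (1 m)
    have le: "1 - x * (1 / q) ^ i = 1 - q ^ (m - i)" if "i \<le> m" for i
      using that q 1 by (simp add: power_diff power_divide)
    show ?thesis
    proof (cases "m < j")
      case True
      then have "q_pochhammer x (1 / q) j = 0"
        unfolding q_pochhammer_def using le[of m] by (intro prod_zero) auto
      then show ?thesis by simp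
    next
      case False
      then show ?thesis unfolding q_pochhammer_def
        using le q by (intro prod_nonneg) (auto simp: power_le_one)
    qed
  next
    case 2
    then show ?thesis by (simp add: q_pochhammer_def)
  qed
qed

lemma nu_weight_snoc:
  assumes q: "0 < q" and w: "w \<in> words n"
  shows "nu_weight q (Suc n) x (w @ [True]) + nu_weight q (Suc n) x (w @ [False]) =
    nu_weight q n x w"
proof -
  define j where "j = ones w"
  have "j \<le> n" using w ones_le_length[of w] by (simp add: j_def words_def)
  then obtain m where n: "n = j + m" using le_Suc_ex by blast
  have len: "length w = j + m" using w n by (simp add: words_def)
  have T: "nu_weight q (Suc n) x (w @ [True]) = q ^ inversions w * q ^ m *
      (x ^ m * (q_pochhammer x (1 / q) j * (1 - x * (1 / q) ^ j)) / (q ^ (j * m) * q ^ m))"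
    using w len by (simp add: nu_weight_word words_def inversions_append n
        power_add q_pochhammer_def mult_ac flip: j_def)
  have F: "nu_weight q (Suc n) x (w @ [False]) = q ^ inversions w *
      (x * x ^ m * q_pochhammer x (1 / q) j / (q ^ (j * m) * q ^ j))"
    using w len by (simp add: nu_weight_word words_def inversions_append n
        power_add Suc_diff_le mult_ac flip: j_def)
  have W: "nu_weight q n x w = q ^ inversions w *
      (x ^ m * q_pochhammer x (1 / q) j / q ^ (j * m))"
    using w by (simp add: nu_weight_word n flip: j_def)
  show ?thesis unfolding T F W using q by (simp add: field_simps power_divide)
qed

lemma sum_nu_weight:
  assumes "0 < q"
  shows "(\<Sum>w\<in>words n. nu_weight q n x w) = 1"
proof (induction n)
  case 0
  then show ?case by (simp add: nu_weight_def q_pochhammer_def)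
next
  case (Suc n)
  then show ?case using nu_weight_snoc[OF assms] by (simp add: sum_words_Suc_snoc)
qed

lemma pmf_embed_nu_weight:
  assumes q: "0 < q" "q < 1" and "x \<in> Delta_q q"
  shows "pmf (embed_pmf (nu_weight q n x)) w = nu_weight q n x w"
proof (rule pmf_embed_words[where n = n])
  have "0 \<le> x" using assms by (auto simp: Delta_q_def)
  then show "0 \<le> nu_weight q n x w" for w
    using q q_pochhammer_nonneg[OF assms] by (auto simp: nu_weight_def)
  show "nu_weight q n x w = 0" if "w \<notin> words n" for w
    using that by (simp add: nu_weight_def)
qed (rule sum_nu_weight[OF q(1)])

lemma nu_spec_embed:
  assumes q: "0 < q" "q < 1" and "x \<in> Delta_q q"
  shows "nu_spec q n x (embed_pmf (nu_weight q n x))"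
  unfolding nu_spec_def q_exchangeable_def pmf_embed_nu_weight[OF assms]
proof (intro conjI ballI allI impI)
  show "set_pmf (embed_pmf (nu_weight q n x)) \<subseteq> words n"
    by (auto simp: set_pmf_iff pmf_embed_nu_weight[OF assms] nu_weight_def split: if_splits)
next
  fix w i assume "w \<in> words n" "Suc i < n"
  then obtain u a b v where w: "w = u @ a # b # v" and i: "length u = i"
    by (rule word_split)
  have words: "u @ a # b # v \<in> words n" "u @ b # a # v \<in> words n"
    using \<open>w \<in> words n\<close> by (auto simp: words_def w)
  have swap: "w[i := w ! Suc i, Suc i := w ! i] = u @ b # a # v"
    unfolding w i[symmetric] by (rule swap_append)
  have at: "w ! i = a" "w ! Suc i = b"
    unfolding w i[symmetric] by (auto simp: nth_append)
  show "nu_weight q n x (w[i := w ! Suc i, Suc i := w ! i]) =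
      q powi (of_bool (w ! i) - of_bool (w ! Suc i)) * nu_weight q n x w"
    unfolding swap unfolding at unfolding w
    using q words by (cases a; cases b)
      (simp_all add: nu_weight_word inversions_append power_add power_int_minus field_simps)
next
  fix j assume "j \<le> n"
  then show "nu_weight q n x (replicate j True @ replicate (n - j) False) =
      q powi (- int (j * (n - j))) * x ^ (n - j) * q_pochhammer x (1 / q) j"
    by (simp add: nu_weight_def words_def inversions_append)
qed

lemma nu_spec_pmf:
  assumes q: "0 < q" and P: "nu_spec q n x P"
  shows "pmf P w = nu_weight q n x w"
proof (cases "w \<in> words n")
  case False
  then have "w \<notin> set_pmf P" using P by (auto simp: nu_spec_def q_exchangeable_def)
  then show ?thesis using False by (simp add: nu_weight_def set_pmf_iff)
next
  case True
  then show ?thesis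
  proof (induction "inversions w" arbitrary: w rule: less_induct)
    case less
    show ?case
    proof (cases w rule: word_cases)
      case 1
      have "ones w \<le> n" using ones_le_length[of w] less.prems by (simp add: words_def)
      moreover have len: "length w = n" using less.prems by (simp add: words_def)
      ultimately have "pmf P (replicate (ones w) True @ replicate (length w - ones w) False) =
          q powi (- int (ones w * (n - ones w))) * x ^ (n - ones w) *
            q_pochhammer x (1 / q) (ones w)"
        using P by (simp add: nu_spec_def)
      moreover have "inversions w = 0"
        by (subst 1) (simp add: inversions_append)
      ultimately show ?thesis
        using less.prems 1[symmetric] by (simp add: nu_weight_def)
    next
      case (2 u v)
      define w' where "w' = u @ True # False # v"
      have w': "w' \<in> words n" using less.prems by (simp add: w'_def 2 words_def)
      have inv: "inversions w = Suc (inversions w')" and ones: "ones w = ones w'"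
        by (simp_all add: w'_def 2 inversions_append)
      have "Suc (length u) < n" using less.prems by (simp add: 2 words_def)
      then have "pmf P (w'[length u := w' ! Suc (length u), Suc (length u) := w' ! length u]) =
          q powi (of_bool (w' ! length u) - of_bool (w' ! Suc (length u))) * pmf P w'"
        using P w' by (simp only: nu_spec_def q_exchangeable_def)
      moreover have "w'[length u := w' ! Suc (length u), Suc (length u) := w' ! length u] = w"
        unfolding w'_def 2 by (rule swap_append)
      moreover have "w' ! length u" "\<not> w' ! Suc (length u)"
        by (simp_all add: w'_def nth_append)
      ultimately have "pmf P w = q * pmf P w'" by simp
      also have "pmf P w' = nu_weight q n x w'" using inv w' by (intro less.hyps) auto
      finally show ?thesis
        using w' less.prems by (simp add: nu_weight_def inv ones)
    qed
  qed
qed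

lemma nu_spec_ex1:
  assumes "0 < q" "q < 1" and "x \<in> Delta_q q"
  shows "\<exists>!P. nu_spec q n x P"
proof (intro ex1I)
  show "nu_spec q n x (embed_pmf (nu_weight q n x))" by (rule nu_spec_embed[OF assms])
next
  fix P assume "nu_spec q n x P"
  then show "P = embed_pmf (nu_weight q n x)"
    using assms by (intro pmf_eqI) (simp add: nu_spec_pmf pmf_embed_nu_weight)
qed

lemma nu_spec_nu_pmf:
  assumes "0 < q" "q < 1" and "x \<in> Delta_q q"
  shows "nu_spec q n x (nu_pmf q n x)"
  unfolding nu_pmf_def by (rule theI'[OF nu_spec_ex1[OF assms]])

end

theory Submission
  imports Defs
begin

text \<open>
  Both measures are compared on the single word $1^k$. There the ratio of the two probabilities is
  $\prod_{i<k} (1 - q^{n-i})^{-1} \ge (1 - q^n)^{-1} \ge 1 + q^n$, and the $\nu$-probability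
  $\prod_{i<k} (1 - q^{n_1-i})$ is at least $(1-q)^k$.
\<close>

text \<open>The singleton event \<open>{u}\<close> competes in the supremum, which is bounded
  because it runs over a finite family.\<close>

lemma var_dist_ge_pmf:
  assumes "u \<in> words k"
  shows "2 * \<bar>pmf \<mu> u - pmf \<nu> u\<bar> \<le> var_dist k \<mu> \<nu>"
proof -
  have "\<bar>measure_pmf.prob \<mu> {u} - measure_pmf.prob \<nu> {u}\<bar> \<le>
      (SUP A\<in>Pow (words k). \<bar>measure_pmf.prob \<mu> A - measure_pmf.prob \<nu> A\<bar>)"
    by (rule cSUP_upper) (use assms in auto)
  then show ?thesis by (simp add: var_dist_def measure_pmf_single)
qed

lemma pmf_marginal:
  assumes supp: "set_pmf P \<subseteq> words (k + m)" and u: "u \<in> words k"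
  shows "pmf (marginal k P) u = (\<Sum>v\<in>words m. pmf P (u @ v))"
proof -
  \<comment> \<open>The intersection with the support matters: \<open>take k w = u\<close> also
    holds for words \<open>w\<close> whose length is not \<open>k + m\<close>.\<close>
  have "(take k -` {u}) \<inter> set_pmf P = ((@) u ` words m) \<inter> set_pmf P"
  proof (intro set_eqI iffI)
    fix w assume w: "w \<in> (take k -` {u}) \<inter> set_pmf P"
    then have "w = u @ drop k w" by (metis IntD1 append_take_drop_id vimage_singleton_eq)
    moreover have "drop k w \<in> words m" using w supp by (auto simp: words_def)
    ultimately show "w \<in> ((@) u ` words m) \<inter> set_pmf P" using w by blast
  qed (use u in \<open>auto simp: words_def\<close>)
  then have "measure_pmf.prob P (take k -` {u}) = measure_pmf.prob P ((@) u ` words m)"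
    by (metis measure_Int_set_pmf)
  also have "\<dots> = (\<Sum>v\<in>words m. pmf P (u @ v))"
    by (simp add: measure_measure_pmf_finite sum.reindex inj_on_def)
  finally show ?thesis by (simp add: marginal_def pmf_map)
qed

text \<open>Consistency of the weights in the length: by \<open>nu_weight_snoc\<close>, summing out
  the last letter turns the weight for \<open>k + Suc m\<close> into the one for
  \<open>k + m\<close>, and this is repeated until only \<open>u\<close> is left.\<close>

lemma sum_nu_weight_append:
  assumes "0 < q" and "u \<in> words k"
  shows "(\<Sum>v\<in>words m. nu_weight q (k + m) x (u @ v)) = nu_weight q k x u"
proof (induction m)
  case (Suc m)
  have "(\<Sum>v\<in>words (Suc m). nu_weight q (k + Suc m) x (u @ v)) =
      (\<Sum>v\<in>words m. nu_weight q (k + m) x (u @ v))"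
    unfolding sum_words_Suc_snoc
    using nu_weight_snoc[OF assms(1), of "u @ v" "k + m" x for v] assms(2)
    by (intro sum.cong) (auto simp: words_def)
  then show ?case using Suc by simp
qed simp

text \<open>The marginal is the measure with the same parameter on words of length \<open>k\<close>,
  so it no longer depends on \<open>n\<close>.\<close>

lemma pmf_marginal_nu:
  assumes q: "0 < q" "q < 1" and x: "x \<in> Delta_q q" and "k \<le> n" and u: "u \<in> words k"
  shows "pmf (marginal k (nu_pmf q n x)) u = nu_weight q k x u"
proof -
  obtain m where n: "n = k + m" using \<open>k \<le> n\<close> le_Suc_ex by blast
  have spec: "nu_spec q n x (nu_pmf q n x)" by (rule nu_spec_nu_pmf[OF q x])
  then have "set_pmf (nu_pmf q n x) \<subseteq> words (k + m)"
    by (simp add: nu_spec_def q_exchangeable_def n)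
  from pmf_marginal[OF this u] show ?thesis
    using sum_nu_weight_append[OF q(1) u] nu_spec_pmf[OF q(1) spec] by (simp add: n)
qed

lemma pmf_marginal_nu_ones:
  assumes q: "0 < q" "q < 1" and "k \<le> n1" "n1 \<le> n"
  shows "pmf (marginal k (nu_pmf q n (q ^ n1))) (replicate k True) = (\<Prod>i<k. 1 - q ^ (n1 - i))"
proof -
  have "pmf (marginal k (nu_pmf q n (q ^ n1))) (replicate k True) =
      nu_weight q k (q ^ n1) (replicate k True)"
    using assms by (intro pmf_marginal_nu) (auto simp: Delta_q_def words_def)
  \<comment> \<open>The word has no zeros and no inversions, so every power of \<open>q\<close> and
    of \<open>x\<close> in the weight is 1.\<close>
  also have "\<dots> = q_pochhammer (q ^ n1) (1 / q) k"
    by (simp add: nu_weight_def words_def)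
  \<comment> \<open>Since \<open>i < k\<close> and \<open>k \<le> n1\<close>, the subtraction is not
    truncated and \<open>q ^ n1 * (1 / q) ^ i\<close> equals \<open>q ^ (n1 - i)\<close>.\<close>
  also have "\<dots> = (\<Prod>i<k. 1 - q ^ (n1 - i))"
    unfolding q_pochhammer_def
    using assms by (intro prod.cong) (auto simp: power_diff power_divide)
  finally show ?thesis .
qed

lemma q_fact_split:
  "k \<le> n \<Longrightarrow> q_fact q n = q_fact q (n - k) * (\<Prod>i<k. q_nat q (n - i))"
proof (induction k)
  case (Suc k)
  then have "n - k = Suc (n - Suc k)" by simp
  then have "q_fact q (n - k) = q_nat q (n - k) * q_fact q (n - Suc k)"
    by (metis q_fact_Suc)
  then show ?case using Suc by simp
qed simp

text \<open>Removing \<open>k\<close> ones leaves the number of zeros at \<open>n - n1\<close>, so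
  that factorial cancels. By \<open>q_fact_split\<close>, only the \<open>k\<close> largest factors
  of the other two factorials survive.\<close>

lemma q_binomial_ratio:
  assumes q: "0 < q" "q < 1" and "k \<le> n1" "n1 \<le> n"
  shows "q_binomial q (n - k) (n1 - k) / q_binomial q n n1 =
    (\<Prod>i<k. 1 - q ^ (n1 - i)) / (\<Prod>i<k. 1 - q ^ (n - i))"
proof -
  have pos: "q_fact q m \<noteq> 0" for m using q_fact_pos[OF q, of m] by simp
  have d: "n - k - (n1 - k) = n - n1" using assms by simp
  have nz: "(\<Prod>i<k. q_nat q (l - i)) \<noteq> 0" if "k \<le> l" for l
    using q_nat_pos[OF q] that by (simp add: order_less_imp_not_eq2)
  have "q_binomial q (n - k) (n1 - k) / q_binomial q n n1 =
      (\<Prod>i<k. q_nat q (n1 - i)) / (\<Prod>i<k. q_nat q (n - i))"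
    unfolding q_binomial_def d
    using pos nz assms q_fact_split[of k n q] q_fact_split[of k n1 q]
    by (simp add: divide_simps)
  \<comment> \<open>Both products have \<open>k\<close> factors, so the denominators
    \<open>1 - q\<close> cancel.\<close>
  also have "\<dots> = (\<Prod>i<k. 1 - q ^ (n1 - i)) / (\<Prod>i<k. 1 - q ^ (n - i))"
    using q by (simp add: q_nat_def prod_dividef)
  finally show ?thesis .
qed

text \<open>Leading ones create no inversions with what follows, so the suffixes contribute the
  generating function of inversions for \<open>n1 - k\<close> ones in \<open>n - k\<close> places,
  which is a q-binomial coefficient.\<close>

lemma pmf_marginal_e_ones:
  assumes q: "0 < q" "q < 1" and k: "k \<le> n1" and n: "n1 \<le> n"
  shows "pmf (marginal k (e_pmf q n n1)) (replicate k True) =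
    (\<Prod>i<k. 1 - q ^ (n1 - i)) / (\<Prod>i<k. 1 - q ^ (n - i))"
proof -
  have kn: "k + (n - k) = n" using k n by simp
  have "set_pmf (e_pmf q n n1) \<subseteq> words (k + (n - k))"
    unfolding kn by (auto simp: set_pmf_iff pmf_e_pmf[OF q n] e_weight_def split: if_splits)
  then have "pmf (marginal k (e_pmf q n n1)) (replicate k True) =
      (\<Sum>v\<in>words (n - k). e_weight q n n1 (replicate k True @ v))"
    by (subst pmf_marginal) (auto simp: words_def pmf_e_pmf[OF q n])
  also have "\<dots> = (\<Sum>v\<in>words (n - k). if ones v = n1 - k then q ^ inversions v else 0) /
      q_binomial q n n1"
    unfolding sum_divide_distrib
    using k n by (intro sum.cong) (auto simp: e_weight_def words_def inversions_append)
  also have "\<dots> = q_binomial q (n - k) (n1 - k) / q_binomial q n n1"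
    using k n by (simp add: sum_inversions[OF q])
  finally show ?thesis using q_binomial_ratio[OF assms] by simp
qed

theorem proposition3p4p6:
  fixes q :: real
  assumes "0 < q" and "q < 1"
  shows "\<forall>k\<ge>1. \<exists>c>0. \<forall>n1 n. k \<le> n1 \<and> n1 \<le> n \<longrightarrow>
    var_dist k (marginal k (e_pmf q n n1)) (marginal k (nu_pmf q n (q ^ n1))) \<ge> c * q ^ n"
proof (intro allI impI exI conjI)
  fix k :: nat
  \<comment> \<open>The witness: 2 is the normalization of \<open>var_dist\<close>, and
    \<open>(1 - q) ^ k\<close> bounds \<open>A\<close> below uniformly in \<open>n1\<close>.\<close>
  show "0 < 2 * (1 - q) ^ k" using assms by simp
  fix n1 n assume "1 \<le> k" and "k \<le> n1 \<and> n1 \<le> n"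
  then have k: "1 \<le> k" "k \<le> n1" "n1 \<le> n" "k \<le> n" by auto
  define A where "A = (\<Prod>i<k. 1 - q ^ (n1 - i))"
  define B where "B = (\<Prod>i<k. 1 - q ^ (n - i))"
  \<comment> \<open>Every exponent \<open>n1 - i\<close> is at least 1, because \<open>i < k\<close>
    and \<open>k \<le> n1\<close>.\<close>
  have "(\<Prod>i<k. 1 - q) \<le> A"
    unfolding A_def
    using assms k power_decreasing[of 1 "n1 - i" q for i] by (intro prod_mono) auto
  then have A: "(1 - q) ^ k \<le> A" by simp
  have B_pos: "0 < B"
    unfolding B_def using assms k by (intro prod_pos) (auto simp: power_less_one_iff)
  \<comment> \<open>Here \<open>1 \<le> k\<close> enters: the factor of index 0, which is
    \<open>1 - q ^ n\<close>, is split off and the others are at most 1.\<close>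
  obtain k' where k': "k = Suc k'" using k(1) by (cases k) auto
  have "B = (1 - q ^ n) * (\<Prod>i<k'. 1 - q ^ (n - Suc i))"
    unfolding B_def k' prod.lessThan_Suc_shift by simp
  also have "\<dots> \<le> (1 - q ^ n) * 1"
    using assms by (intro mult_left_mono prod_le_1) (auto simp: power_le_one)
  finally have B_le: "B \<le> 1 - q ^ n" by simp
  \<comment> \<open>From \<open>B \<le> 1\<close> comes \<open>q ^ n * B \<le> q ^ n\<close>, which
    is at most \<open>1 - B\<close>; dividing by \<open>B\<close> gives the bound on
    \<open>1 / B - 1\<close>.\<close>
  have "q ^ n * B \<le> q ^ n * 1"
    using assms B_le by (intro mult_left_mono) (auto intro: order_trans)
  then have "q ^ n * B \<le> 1 - B" using B_le by simp
  then have "q ^ n \<le> 1 / B - 1" using B_pos by (simp add: field_simps)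
  then have "(1 - q) ^ k * q ^ n \<le> A * (1 / B - 1)"
    using A assms by (intro mult_mono) (auto intro: order_trans[of _ "(1 - q) ^ k"])
  also have "\<dots> \<le> \<bar>A / B - A\<bar>" by (simp add: algebra_simps)
  finally have "2 * (1 - q) ^ k * q ^ n \<le> 2 * \<bar>A / B - A\<bar>" by simp
  also have "\<dots> \<le> var_dist k (marginal k (e_pmf q n n1)) (marginal k (nu_pmf q n (q ^ n1)))"
    using var_dist_ge_pmf[of "replicate k True" k
        "marginal k (e_pmf q n n1)" "marginal k (nu_pmf q n (q ^ n1))"] assms k
    by (simp add: pmf_marginal_e_ones pmf_marginal_nu_ones words_def A_def B_def)
  finally show "2 * (1 - q) ^ k * q ^ n \<le>
      var_dist k (marginal k (e_pmf q n n1)) (marginal k (nu_pmf q n (q ^ n1)))" .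
qed

end
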